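(* For a knot diagram $D$ with $c(D)\ge 1$, we have $W_D(-1)=0$.
   Context: All knot diagrams are oriented and lie on $S^2$. $c(D)$ is the number of crossings of the diagram $D$. A base point $b$ of a knot diagram $D$ is a point of $D$ that is not a crossing point. A crossing point of $D$ is a warping crossing point of $D_b=(D,b)$ if, going along $D$ following its orientation starting from $b$, one meets that crossing first as an under-crossing. The warping degree $d(D_b)$ is the number of warping crossing points of $D_b$. An edge of $D$ is a path on $D$ between (consecutive) crossing points with no crossings in its interior. The warping degree $i(e)$ of an edge $e$ is $d(D_b)$ for any base point $b$ on $e$. The warping polynomial of $D$ is $W_D(t)=\sum_e t^{i(e)}$, the sum over all edges $e$ of $D$. *)

theory Defs
  imports "HOL-Analysis.Analysis" "HOL-Computational_Algebra.Polynomial"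
begin

text \<open>
  An oriented knot diagram is given by a closed curve, written as a function on the real line with
  period 1 (so parameters differing by an integer are the same point of the circle), traversed in
  the direction of increasing parameter. The predicate \<open>under\<close> holds of a parameter at which the
  curve passes a crossing as the lower strand.
\<close>

record diagram =
  curve :: "real \<Rightarrow> real ^ 3"
  under :: "real \<Rightarrow> bool"

definition crossings :: "diagram \<Rightarrow> (real ^ 3) set" where
  "crossings D = {x. \<exists>s t. s - t \<notin> \<int> \<and> curve D s = x \<and> curve D t = x}"

text \<open>
  The curve is a regular \<open>C\<^sup>1\<close> closed curve on the 2-sphere whose only multiple points are finitely
  many transverse double points (the two velocities are linearly independent, i.e. not collinear
  with 0), with one strand over and the other one under at each of them.
\<close>

definition knot_diagram :: "diagram \<Rightarrow> bool" where
  "knot_diagram D \<longleftrightarrow>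
     range (curve D) \<subseteq> sphere 0 1 \<and>
     (\<forall>t. curve D (t + 1) = curve D t) \<and>
     (\<forall>t. under D (t + 1) = under D t) \<and>
     curve D C1_differentiable_on UNIV \<and>
     (\<forall>t. vector_derivative (curve D) (at t) \<noteq> 0) \<and>
     finite (crossings D) \<and>
     (\<forall>r s t. curve D r = curve D s \<and> curve D s = curve D t \<longrightarrow>
        r - s \<in> \<int> \<or> s - t \<in> \<int> \<or> r - t \<in> \<int>) \<and>
     (\<forall>s t. curve D s = curve D t \<and> s - t \<notin> \<int> \<longrightarrow>
        \<not> collinear {0, vector_derivative (curve D) (at s), vector_derivative (curve D) (at t)} \<and>
        under D s \<noteq> under D t)"

definition crossing_number :: "diagram \<Rightarrow> nat" where
  "crossing_number D = card (crossings D)"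

definition base_point :: "diagram \<Rightarrow> real ^ 3 \<Rightarrow> bool" where
  "base_point D b \<longleftrightarrow> b \<in> range (curve D) - crossings D"

text \<open>
  Below, \<open>t\<close> is the first parameter after the base point at which the crossing \<open>x\<close> is met. The choice
  of the parameter \<open>s\<close> of the base point is immaterial, as it is unique up to integer translation.
\<close>

definition warping_crossings :: "diagram \<Rightarrow> real ^ 3 \<Rightarrow> (real ^ 3) set" where
  "warping_crossings D b = {x \<in> crossings D. \<exists>s t.
     curve D s = b \<and> s < t \<and> curve D t = x \<and> (\<forall>r. s < r \<and> r < t \<longrightarrow> curve D r \<noteq> x) \<and> under D t}"

definition warping_degree :: "diagram \<Rightarrow> real ^ 3 \<Rightarrow> nat" where
  "warping_degree D b = card (warping_crossings D b)"

text \<open>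
  Edges are represented by their (closed) images on the sphere, which determine them. A diagram
  without crossings has no edges in this sense.
\<close>

definition edges :: "diagram \<Rightarrow> (real ^ 3) set set" where
  "edges D = {curve D ` {a..b} | a b.
     a < b \<and> curve D a \<in> crossings D \<and> curve D b \<in> crossings D \<and>
     (\<forall>t. a < t \<and> t < b \<longrightarrow> curve D t \<notin> crossings D)}"

definition edge_warping_degree :: "diagram \<Rightarrow> (real ^ 3) set \<Rightarrow> nat" where
  "edge_warping_degree D e = (THE d. \<forall>b\<in>e. base_point D b \<longrightarrow> warping_degree D b = d)"

definition warping_polynomial :: "diagram \<Rightarrow> int poly" where
  "warping_polynomial D = (\<Sum>e\<in>edges D. monom 1 (edge_warping_degree D e))"

end

theory Submission
  imports Defs
begin

text \<open>
  When the base point is moved along the diagram through one passage of a crossing \<open>x\<close>, the first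
  meeting with \<open>x\<close> changes from this passage to the other one, which is an under-passage exactly if
  this one is not; the first meetings with all other crossings stay the same. So \<open>x\<close> is added to or
  removed from the set of warping crossings, and the warping degrees of two consecutive edges have
  opposite parities (\<open>warping_after_next_passage\<close>). Going from an edge to the following one permutes
  the edges, and it negates the terms of \<open>W\<^sub>D(-1) = (\<Sum>e. (-1) ^ i(e))\<close>. Hence
  \<open>W\<^sub>D(-1) = - W\<^sub>D(-1)\<close>, that is, \<open>W\<^sub>D(-1) = 0\<close>.

  The permutation is described on parameters: an edge corresponds to the unique parameter in \<open>[0,1)\<close>
  at which it starts, and the following edge starts at the next parameter of a crossing, reduced
  modulo 1. Finiteness of the set of such parameters gives both the existence of a next one and the
  surjectivity of the map to the following edge, once it is known to be injective.
\<close>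

section \<open>Parameters of crossings\<close>

definition passages :: "diagram \<Rightarrow> real set" where
  "passages D = {t. curve D t \<in> crossings D}"

text \<open>
  Since every half-open interval of length 1 contains passages as soon as there is a crossing, the minimum
  below is that of all later passages.
\<close>

definition next_passage :: "diagram \<Rightarrow> real \<Rightarrow> real" where
  "next_passage D a = Min (passages D \<inter> {a<..a+1})"

text \<open>
  This makes sense for every parameter \<open>s\<close>, also at a passage. There it is the set of warping
  crossings for a base point shortly after \<open>s\<close>, and it attaches a warping degree to the starting
  parameter of an edge.
\<close>

definition warping_after :: "diagram \<Rightarrow> real \<Rightarrow> (real ^ 3) set" where
  "warping_after D s = {x \<in> crossings D. \<exists>t. s < t \<and> curve D t = x \<and>
     (\<forall>r. s < r \<and> r < t \<longrightarrow> curve D r \<noteq> x) \<and> under D t}"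

lemma periodic_int:
  fixes f :: "real \<Rightarrow> 'a"
  assumes "\<And>t. f (t + 1) = f t"
  shows "f (t + of_int k) = f t"
proof (induction k rule: int_induct[where k=0])
  case base
  show ?case by simp
next
  case (step1 i)
  then show ?case using assms[of "t + of_int i"] by (simp add: add.assoc)
next
  case (step2 i)
  then show ?case using assms[of "t + of_int (i - 1)"] by (simp add: algebra_simps)
qed

lemma curve_int:
  "knot_diagram D \<Longrightarrow> curve D (t + of_int k) = curve D t"
  by (rule periodic_int) (auto simp: knot_diagram_def)

lemma under_int:
  "knot_diagram D \<Longrightarrow> under D (t + of_int k) = under D t"
  by (rule periodic_int) (auto simp: knot_diagram_def)

lemma passages_int:
  "knot_diagram D \<Longrightarrow> t + of_int k \<in> passages D \<longleftrightarrow> t \<in> passages D"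
  by (simp add: passages_def curve_int)

lemma at_most_double:
  assumes "knot_diagram D" "curve D r = curve D s" "curve D s = curve D t"
  shows "r - s \<in> \<int> \<or> s - t \<in> \<int> \<or> r - t \<in> \<int>"
proof -
  have "\<forall>r s t. curve D r = curve D s \<and> curve D s = curve D t \<longrightarrow>
      r - s \<in> \<int> \<or> s - t \<in> \<int> \<or> r - t \<in> \<int>"
    using assms(1) unfolding knot_diagram_def by (elim conjE)
  then show ?thesis using assms(2,3) by simp
qed

lemma not_crossing_Ints:
  "curve D s \<notin> crossings D \<Longrightarrow> curve D s = curve D t \<Longrightarrow> s - t \<in> \<int>"
  by (force simp: crossings_def)

lemma not_Ints_between:
  fixes x :: real
  shows "0 < x \<Longrightarrow> x < 1 \<Longrightarrow> x \<notin> \<int>"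
  by (auto elim!: Ints_cases)

lemma ex_int_shift:
  fixes a t :: real
  obtains k where "a < t + of_int k" "t + of_int k \<le> a + 1"
proof
  show "a < t + of_int (\<lfloor>a - t\<rfloor> + 1)" "t + of_int (\<lfloor>a - t\<rfloor> + 1) \<le> a + 1"
    by linarith+
qed

text \<open>
  The other strand through a crossing: no third passage can lie within one period because multiple
  points are at most double.
\<close>

lemma other_passage:
  assumes K: "knot_diagram D" and "q \<in> passages D"
  obtains q' where "q < q'" "curve D q' = curve D q" "under D q' \<noteq> under D q"
    "\<And>r. q < r \<Longrightarrow> r < q' \<Longrightarrow> curve D r \<noteq> curve D q"
proof -
  obtain s t where st: "s - t \<notin> \<int>" "curve D s = curve D q" "curve D t = curve D q"
    using assms(2) by (auto simp: passages_def crossings_def)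
  obtain u where u: "u - q \<notin> \<int>" "curve D u = curve D q"
  proof (cases "s - q \<in> \<int>")
    case True
    then have "t - q \<notin> \<int>" using st(1) Ints_diff[of "s - q" "t - q"] by auto
    then show ?thesis using that st by blast
  qed (use that st in blast)
  obtain k where k: "q < u + of_int k" "u + of_int k \<le> q + 1"
    by (rule ex_int_shift)
  define q' where "q' = u + of_int k"
  have q'Z: "q' - q \<notin> \<int>"
  proof
    assume "q' - q \<in> \<int>"
    then have "(q' - q) - of_int k \<in> \<int>" by (rule Ints_diff) (rule Ints_of_int)
    then show False using u(1) by (simp add: q'_def algebra_simps)
  qed
  have q'lt: "q' < q + 1" using k(2) q'Z by (cases "q' = q + 1") (auto simp: q'_def)
  have eq: "curve D q' = curve D q" using u(2) by (simp add: q'_def curve_int[OF K])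
  show thesis
  proof (rule that)
    show "q < q'" using k by (simp add: q'_def)
    show "curve D q' = curve D q" by fact
    show "under D q' \<noteq> under D q" using K eq q'Z unfolding knot_diagram_def by blast
    fix r assume r: "q < r" "r < q'"
    show "curve D r \<noteq> curve D q"
    proof
      assume "curve D r = curve D q"
      then have "q' - r \<in> \<int> \<or> r - q \<in> \<int> \<or> q' - q \<in> \<int>"
        using at_most_double[OF K, of q' r q] eq by simp
      then show False
        using q'Z not_Ints_between[of "q' - r"] not_Ints_between[of "r - q"] r q'lt by auto
    qed
  qed
qed

text \<open>
  A half-open period contains at most two parameters of each crossing, because three of them would
  be pairwise incongruent modulo 1; and there are finitely many crossings.
\<close>

lemma finite_passages:
  assumes K: "knot_diagram D"
  shows "finite (passages D \<inter> {a<..a+1})"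
proof -
  have "finite {t \<in> {a<..a+1}. curve D t = x}" (is "finite ?F") for x
  proof (rule ccontr)
    assume "infinite ?F"
    then obtain A where A: "A \<subseteq> ?F" "card A = 3"
      using infinite_arbitrarily_large by blast
    then obtain r s t where rst: "A = {r,s,t}" "r \<noteq> s" "s \<noteq> t" "r \<noteq> t"
      by (auto simp: card_3_iff)
    have noZ: "u - v \<notin> \<int>" if "u \<in> ?F" "v \<in> ?F" "u \<noteq> v" for u v
      using that not_Ints_between[of "u - v"] not_Ints_between[of "v - u"]
        Ints_minus[of "u - v"] by (cases u v rule: linorder_cases) auto
    have "curve D r = curve D s" "curve D s = curve D t" using A rst by auto
    then have "r - s \<in> \<int> \<or> s - t \<in> \<int> \<or> r - t \<in> \<int>" by (rule at_most_double[OF K])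
    then show False using noZ A rst by blast
  qed
  then have "finite (\<Union>x\<in>crossings D. {t \<in> {a<..a+1}. curve D t = x})"
    using K by (auto simp: knot_diagram_def)
  then show ?thesis by (rule finite_subset[rotated]) (auto simp: passages_def)
qed

lemma next_passage:
  assumes K: "knot_diagram D" and "crossing_number D \<ge> 1"
  shows "a < next_passage D a" "next_passage D a \<in> passages D"
    "\<And>r. a < r \<Longrightarrow> r < next_passage D a \<Longrightarrow> r \<notin> passages D"
proof -
  let ?P = "passages D \<inter> {a<..a+1}"
  have "crossings D \<noteq> {}" using assms(2) by (auto simp: crossing_number_def)
  then obtain t where t: "t \<in> passages D" by (auto simp: passages_def crossings_def)
  obtain k where "a < t + of_int k" "t + of_int k \<le> a + 1" by (rule ex_int_shift)
  then have ne: "?P \<noteq> {}" using t passages_int[OF K, of t k] by auto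
  note fin = finite_passages[OF K, of a]
  have in_P: "next_passage D a \<in> ?P" using Min_in[OF fin ne] by (simp add: next_passage_def)
  then show "a < next_passage D a" "next_passage D a \<in> passages D" by auto
  fix r assume r: "a < r" "r < next_passage D a"
  show "r \<notin> passages D"
  proof
    assume "r \<in> passages D"
    then have "r \<in> ?P" using r in_P by auto
    then show False using Min_le[OF fin, of r] r(2) by (simp add: next_passage_def)
  qed
qed

lemma next_passage_eqI:
  assumes K: "knot_diagram D" and C: "crossing_number D \<ge> 1"
    and "a < b" "b \<in> passages D" "\<And>r. a < r \<Longrightarrow> r < b \<Longrightarrow> r \<notin> passages D"
  shows "next_passage D a = b"
  using next_passage[OF K C, of a] assms(3-5) by (metis linorder_neqE_linordered_idom)

lemma next_passage_int:
  assumes K: "knot_diagram D" and C: "crossing_number D \<ge> 1"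
  shows "next_passage D (a + of_int k) = next_passage D a + of_int k"
proof (rule next_passage_eqI[OF K C])
  note n = next_passage[OF K C, of a]
  show "a + of_int k < next_passage D a + of_int k" using n by simp
  show "next_passage D a + of_int k \<in> passages D" using n passages_int[OF K] by simp
  fix r assume "a + of_int k < r" "r < next_passage D a + of_int k"
  then have "r - of_int k \<notin> passages D" using n(3)[of "r - of_int k"] by simp
  then show "r \<notin> passages D" using passages_int[OF K, of "r - of_int k" k] by simp
qed

lemma passages_eq_if_common_point:
  assumes K: "knot_diagram D" and C: "crossing_number D \<ge> 1"
    and "p \<in> passages D" "q \<in> passages D"
    and "p < r" "r \<le> next_passage D p" "q < r" "r \<le> next_passage D q"
  shows "p = q"
  using next_passage(3)[OF K C, of p q] next_passage(3)[OF K C, of q p] assms(3-)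
  by (cases p q rule: linorder_cases) auto

section \<open>Warping crossings\<close>

lemma warping_after_iff_not_met:
  assumes "p \<le> q" "\<And>r. p < r \<Longrightarrow> r \<le> q \<Longrightarrow> curve D r \<noteq> x"
  shows "x \<in> warping_after D p \<longleftrightarrow> x \<in> warping_after D q"
proof -
  have met: "x \<in> warping_after D s \<longleftrightarrow> x \<in> crossings D \<and> (\<exists>t. (s < t \<and> curve D t = x) \<and>
      (\<forall>r. s < r \<and> curve D r = x \<longrightarrow> \<not> r < t) \<and> under D t)" for s
    by (auto simp: warping_after_def)
  have "p < t \<and> curve D t = x \<longleftrightarrow> q < t \<and> curve D t = x" for t
    using assms(1) assms(2)[of t] by (auto simp: not_less[symmetric])
  then show ?thesis unfolding met by simp
qed

lemma warping_after_eq: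
  assumes "p \<le> q" "\<And>r. p < r \<Longrightarrow> r \<le> q \<Longrightarrow> r \<notin> passages D"
  shows "warping_after D p = warping_after D q"
proof (rule set_eqI)
  fix x
  show "x \<in> warping_after D p \<longleftrightarrow> x \<in> warping_after D q"
  proof (cases "x \<in> crossings D")
    case True
    then show ?thesis using assms by (intro warping_after_iff_not_met) (auto simp: passages_def)
  qed (simp add: warping_after_def)
qed

lemma warping_after_iff_first:
  assumes "curve D t = x" "x \<in> crossings D" "s < t" "\<And>r. s < r \<Longrightarrow> r < t \<Longrightarrow> curve D r \<noteq> x"
  shows "x \<in> warping_after D s \<longleftrightarrow> under D t"
proof
  assume "x \<in> warping_after D s"
  then obtain u where "s < u" "curve D u = x" "\<forall>r. s < r \<and> r < u \<longrightarrow> curve D r \<noteq> x" "under D u"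
    by (auto simp: warping_after_def)
  then show "under D t" using assms by (cases u t rule: linorder_cases) auto
qed (use assms in \<open>auto simp: warping_after_def\<close>)

lemma warping_after_int:
  assumes K: "knot_diagram D"
  shows "warping_after D (s + of_int k) = warping_after D s"
proof -
  have sub: "warping_after D s \<subseteq> warping_after D (s + of_int k)" for s k
  proof
    fix x assume "x \<in> warping_after D s"
    then obtain t where x: "x \<in> crossings D" "s < t" "curve D t = x"
      "\<And>r. s < r \<Longrightarrow> r < t \<Longrightarrow> curve D r \<noteq> x" "under D t"
      by (auto simp: warping_after_def)
    have "curve D r \<noteq> x" if "s + of_int k < r" "r < t + of_int k" for r
      using x(4)[of "r - of_int k"] that curve_int[OF K, of "r - of_int k" k] by simp
    moreover have "curve D (t + of_int k) = x" "under D (t + of_int k)"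
      using x curve_int[OF K] under_int[OF K] by auto
    ultimately show "x \<in> warping_after D (s + of_int k)"
      using warping_after_iff_first[of D "t + of_int k" x "s + of_int k"] x(1,2) by simp
  qed
  show ?thesis using sub[of s k] sub[of "s + of_int k" "- k"] by auto
qed

text \<open>
  The parameter of a base point is unique up to an integer, since multiple points are crossings, and
  an integer shift does not affect \<open>warping_after\<close>.
\<close>

lemma warping_crossings_eq_warping_after:
  assumes K: "knot_diagram D" and "s \<notin> passages D"
  shows "warping_crossings D (curve D s) = warping_after D s"
proof -
  have eq: "warping_after D s' = warping_after D s" if "curve D s' = curve D s" for s'
  proof -
    have "s' - s \<in> \<int>"
      using that assms(2) not_crossing_Ints[of D s' s] by (simp add: passages_def)
    then obtain k where "s' - s = of_int k" by (auto elim: Ints_cases)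
    then have "s' = s + of_int k" by simp
    then show ?thesis using warping_after_int[OF K] by simp
  qed
  have "warping_crossings D (curve D s) =
      (\<Union>s'\<in>{s'. curve D s' = curve D s}. warping_after D s')"
    unfolding warping_crossings_def warping_after_def by blast
  also have "\<dots> = (\<Union>s'\<in>{s'. curve D s' = curve D s}. warping_after D s)"
    by (intro SUP_cong refl eq) simp
  also have "\<dots> = warping_after D s" by auto
  finally show ?thesis .
qed

text \<open>
  Let \<open>q\<close> be the passage that follows \<open>p\<close>. The sets of warping crossings for base points before and
  after \<open>q\<close> differ exactly in the crossing at \<open>q\<close>: it is first met at \<open>q\<close> itself from before and at
  its other passage from after, and only one of these two is an under-passage.
\<close>

lemma warping_after_next_passage:
  assumes K: "knot_diagram D" and C: "crossing_number D \<ge> 1"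
  shows "(-1 :: int) ^ card (warping_after D (next_passage D p)) =
         - ((-1) ^ card (warping_after D p))"
proof -
  define q where "q = next_passage D p"
  define x where "x = curve D q"
  have q: "p < q" "q \<in> passages D" "\<And>r. p < r \<Longrightarrow> r < q \<Longrightarrow> r \<notin> passages D"
    using next_passage[OF K C, of p] by (auto simp: q_def)
  have xc: "x \<in> crossings D" using q(2) by (simp add: x_def passages_def)
  have fin: "finite (warping_after D s)" for s
    using K by (auto simp: knot_diagram_def warping_after_def)
  have other: "y \<in> warping_after D p \<longleftrightarrow> y \<in> warping_after D q" if "y \<noteq> x" for y
  proof (cases "y \<in> crossings D")
    case True
    then have "curve D r \<noteq> y" if "p < r" "r \<le> q" for r
      using that q(3)[of r] \<open>y \<noteq> x\<close> by (cases "r = q") (auto simp: passages_def x_def)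
    then show ?thesis using q(1) by (intro warping_after_iff_not_met) auto
  qed (simp add: warping_after_def)
  have before: "x \<in> warping_after D p \<longleftrightarrow> under D q"
  proof (rule warping_after_iff_first)
    fix r assume "p < r" "r < q"
    then have "curve D r \<notin> crossings D" using q(3) by (simp add: passages_def)
    then show "curve D r \<noteq> x" using xc by auto
  qed (use q xc in \<open>simp_all add: x_def\<close>)
  obtain q' where q': "q < q'" "curve D q' = curve D q" "under D q' \<noteq> under D q"
    "\<And>r. q < r \<Longrightarrow> r < q' \<Longrightarrow> curve D r \<noteq> curve D q"
    using other_passage[OF K q(2)] by blast
  have after: "x \<in> warping_after D q \<longleftrightarrow> \<not> under D q"
    using warping_after_iff_first[of D q' x q] q' xc by (auto simp: x_def)
  show ?thesis
  proof (cases "under D q")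
    case True
    then have x: "x \<in> warping_after D p" "x \<notin> warping_after D q" using before after by auto
    have "warping_after D p = insert x (warping_after D q)"
      by (rule set_eqI) (metis insert_iff other x(1))
    then show ?thesis using fin x(2) by (simp add: q_def)
  next
    case False
    then have x: "x \<in> warping_after D q" "x \<notin> warping_after D p" using before after by auto
    have "warping_after D q = insert x (warping_after D p)"
      by (rule set_eqI) (metis insert_iff other x(1))
    then show ?thesis using fin x(2) by (simp add: q_def)
  qed
qed

section \<open>Edges and the passage to the following edge\<close>

definition edge_from :: "diagram \<Rightarrow> real \<Rightarrow> (real ^ 3) set" where
  "edge_from D p = curve D ` {p..next_passage D p}"

text \<open>
  The definite description in \<open>edge_warping_degree\<close> needs a base point on the edge for uniqueness;
  the midpoint of the parameter interval provides one.
\<close>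

lemma edge_warping_degree_edge_from:
  assumes K: "knot_diagram D" and C: "crossing_number D \<ge> 1" and p: "p \<in> passages D"
  shows "edge_warping_degree D (edge_from D p) = card (warping_after D p)"
proof -
  note n = next_passage[OF K C, of p]
  have deg: "warping_degree D (curve D s) = card (warping_after D p)"
    if "p < s" "s < next_passage D p" for s
  proof -
    have "warping_after D p = warping_after D s" using that n(3) by (intro warping_after_eq) auto
    then show ?thesis
      using warping_crossings_eq_warping_after[OF K n(3)[OF that]] by (simp add: warping_degree_def)
  qed
  have base: "base_point D (curve D s)" if "p < s" "s < next_passage D p" for s
    using n(3)[OF that] by (simp add: base_point_def passages_def)
  have all: "warping_degree D b = card (warping_after D p)"
    if b: "b \<in> edge_from D p" "base_point D b" for b
  proof -
    obtain s where s: "b = curve D s" "p \<le> s" "s \<le> next_passage D p"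
      using b(1) by (auto simp: edge_from_def)
    have "s \<noteq> p" "s \<noteq> next_passage D p"
      using b(2) p n(2) s(1) by (auto simp: base_point_def passages_def)
    then show ?thesis using s deg[of s] by simp
  qed
  define m where "m = (p + next_passage D p) / 2"
  have "p < m" "m < next_passage D p" using n(1) by (simp_all add: m_def)
  then have m: "curve D m \<in> edge_from D p" "base_point D (curve D m)"
    "warping_degree D (curve D m) = card (warping_after D p)"
    using base deg by (auto simp: edge_from_def)
  show ?thesis unfolding edge_warping_degree_def
    by (rule the_equality) (use all m in auto)
qed

lemma edge_from_int:
  assumes K: "knot_diagram D" and C: "crossing_number D \<ge> 1"
  shows "edge_from D (p + of_int k) = edge_from D p"
proof -
  have "{p + of_int k..next_passage D p + of_int k} = (\<lambda>t. t + of_int k) ` {p..next_passage D p}"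
    by (rule image_add_atLeastAtMost'[symmetric])
  then have "curve D ` {p + of_int k..next_passage D p + of_int k} = curve D ` {p..next_passage D p}"
    by (simp only: image_image curve_int[OF K])
  then show ?thesis by (simp add: edge_from_def next_passage_int[OF K C])
qed

text \<open>
  An interior point of an edge is passed only once per period, so already its midpoint determines,
  up to an integer, the interval of parameters that the edge comes from.
\<close>

lemma edge_from_eqD:
  assumes K: "knot_diagram D" and C: "crossing_number D \<ge> 1"
    and p: "p \<in> passages D" and q: "q \<in> passages D" and eq: "edge_from D p = edge_from D q"
  shows "p - q \<in> \<int>"
proof -
  note np = next_passage[OF K C, of p] and nq = next_passage[OF K C, of q]
  define m where "m = (p + next_passage D p) / 2"
  have m: "p < m" "m < next_passage D p" using np(1) by (simp_all add: m_def)
  then have mP: "m \<notin> passages D" using np(3) by blast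
  have "curve D m \<in> edge_from D q" using m eq by (auto simp: edge_from_def)
  then obtain r where r: "curve D m = curve D r" "q \<le> r" "r \<le> next_passage D q"
    by (auto simp: edge_from_def)
  have "r \<noteq> q" using mP q r(1) by (auto simp: passages_def)
  have "m - r \<in> \<int>" using not_crossing_Ints[of D m r] mP r(1) by (simp add: passages_def)
  then obtain k where "m - r = of_int k" by (auto elim: Ints_cases)
  then have k: "m = r + of_int k" by simp
  have "p = q + of_int k"
    using m r \<open>r \<noteq> q\<close> p q passages_int[OF K, of q k] next_passage_int[OF K C, of q k] k
    by (intro passages_eq_if_common_point[OF K C, of p "q + of_int k" m]) auto
  then show ?thesis by simp
qed

lemma frac_eq_add_int:
  fixes x :: real
  shows "frac x = x + of_int (- \<lfloor>x\<rfloor>)"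
  by (simp add: frac_def)

lemma Ints_diff_unit_interval:
  fixes p q :: real
  assumes "p \<in> {0..<1}" "q \<in> {0..<1}" "p - q \<in> \<int>"
  shows "p = q"
  using assms not_Ints_between[of "p - q"] not_Ints_between[of "q - p"] Ints_minus[of "p - q"]
  by (cases p q rule: linorder_cases) auto

lemma frac_mem_passages:
  assumes "knot_diagram D" "p \<in> passages D"
  shows "frac p \<in> passages D \<inter> {0..<1}"
  using assms(2) passages_int[OF assms(1), of p "- \<lfloor>p\<rfloor>"]
  by (simp add: frac_def frac_lt_1[unfolded frac_def])

lemma bij_betw_edge_from:
  assumes K: "knot_diagram D" and C: "crossing_number D \<ge> 1"
  shows "bij_betw (edge_from D) (passages D \<inter> {0..<1}) (edges D)"
  unfolding bij_betw_def
proof (intro conjI subset_antisym subsetI)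
  show "inj_on (edge_from D) (passages D \<inter> {0..<1})"
    using edge_from_eqD[OF K C] Ints_diff_unit_interval by (intro inj_onI) blast
next
  fix e assume "e \<in> edge_from D ` (passages D \<inter> {0..<1})"
  then obtain p where "p \<in> passages D" "e = edge_from D p" by auto
  then show "e \<in> edges D"
    using next_passage[OF K C, of p] unfolding edges_def edge_from_def passages_def by blast
next
  fix e assume "e \<in> edges D"
  then obtain a b where ab: "e = curve D ` {a..b}" "a < b" "a \<in> passages D" "b \<in> passages D"
    "\<And>r. a < r \<Longrightarrow> r < b \<Longrightarrow> r \<notin> passages D"
    by (auto simp: edges_def passages_def)
  then have "e = edge_from D a"
    using next_passage_eqI[OF K C, of a b] by (simp add: edge_from_def)
  also have "\<dots> = edge_from D (frac a)"
    using edge_from_int[OF K C, of a "- \<lfloor>a\<rfloor>"] by (simp only: frac_eq_add_int)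
  finally show "e \<in> edge_from D ` (passages D \<inter> {0..<1})"
    using frac_mem_passages[OF K ab(3)] by blast
qed

text \<open>
  Each starting parameter is recovered modulo 1 from the next passage, because the half-open
  intervals from a passage to the next one are disjoint. Injectivity suffices by finiteness.
\<close>

lemma bij_betw_next_passage:
  assumes K: "knot_diagram D" and C: "crossing_number D \<ge> 1"
  shows "bij_betw (\<lambda>p. frac (next_passage D p)) (passages D \<inter> {0..<1}) (passages D \<inter> {0..<1})"
    (is "bij_betw ?f ?Q ?Q")
proof -
  have "?Q \<subseteq> passages D \<inter> {-1<..-1+1} \<union> passages D \<inter> {0<..0+1}" by auto
  then have fin: "finite ?Q"
    using finite_passages[OF K] by (meson finite_UnI finite_subset)
  have inj: "inj_on ?f ?Q"
  proof (rule inj_onI)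
    fix p q assume p: "p \<in> ?Q" and q: "q \<in> ?Q" and eq: "?f p = ?f q"
    define k where "k = \<lfloor>next_passage D p\<rfloor> - \<lfloor>next_passage D q\<rfloor>"
    have n: "next_passage D p = next_passage D (q + of_int k)"
      unfolding next_passage_int[OF K C] using eq by (simp add: frac_def k_def)
    have "q + of_int k \<in> passages D" using q passages_int[OF K] by simp
    then have "p = q + of_int k"
      using p n next_passage(1)[OF K C, of p] next_passage(1)[OF K C, of "q + of_int k"]
      by (intro passages_eq_if_common_point[OF K C, where r = "next_passage D p"]) auto
    then show "p = q" using p q by (intro Ints_diff_unit_interval) auto
  qed
  have "?f ` ?Q \<subseteq> ?Q"
    using frac_mem_passages[OF K next_passage(2)[OF K C]] by blast
  then have "?f ` ?Q = ?Q" by (rule endo_inj_surj[OF fin _ inj])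
  then show ?thesis using inj by (simp add: bij_betw_def)
qed

theorem lemma2p9:
  fixes D :: diagram
  assumes "knot_diagram D" and "crossing_number D \<ge> 1"
  shows "poly (warping_polynomial D) (-1) = 0"
proof -
  let ?Q = "passages D \<inter> {0..<1}"
  define sgn where "sgn p = (-1 :: int) ^ card (warping_after D p)" for p
  have sgn_frac: "sgn (frac p) = sgn p" for p
    using warping_after_int[OF assms(1), of p "- \<lfloor>p\<rfloor>"] by (simp only: sgn_def frac_eq_add_int)
  have "poly (warping_polynomial D) (-1) = (\<Sum>e\<in>edges D. (-1) ^ edge_warping_degree D e)"
    by (simp add: warping_polynomial_def poly_sum poly_monom)
  also have "\<dots> = (\<Sum>p\<in>?Q. (-1) ^ edge_warping_degree D (edge_from D p))"
    by (rule sum.reindex_bij_betw[OF bij_betw_edge_from[OF assms], symmetric])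
  also have "\<dots> = sum sgn ?Q"
    by (intro sum.cong) (auto simp: sgn_def edge_warping_degree_edge_from[OF assms])
  finally have W: "poly (warping_polynomial D) (-1) = sum sgn ?Q" .
  have "sum sgn ?Q = (\<Sum>p\<in>?Q. sgn (frac (next_passage D p)))"
    by (rule sum.reindex_bij_betw[OF bij_betw_next_passage[OF assms], symmetric])
  also have "\<dots> = (\<Sum>p\<in>?Q. - sgn p)"
    by (simp only: sgn_frac) (simp only: sgn_def warping_after_next_passage[OF assms])
  also have "\<dots> = - sum sgn ?Q" by (rule sum_negf)
  finally show ?thesis using W by simp
qed

end
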